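(* Let $(X,d)$ be a metric space. (a) Let $\theta=(k_t)_{t\ge0}$ be a lacunary sequence and $f$ an unbounded modulus function. Then $WN_\theta^f\subset WS_\theta^f$. (b) Let $\theta=(k_t)_{t\ge0}$ be a lacunary sequence and $f$ a $\theta$-compatible unbounded modulus function. Then $WS_\theta^f\cap WI_\theta\subset WN_\theta^f$.
   Context: $\mathbb{R}^+=[0,\infty)$. A modulus function is a function $f:\mathbb{R}^+\to\mathbb{R}^+$ such that: $f(x)=0$ if and only if $x=0$; $f(x+y)\le f(x)+f(y)$ for all $x,y\in\mathbb{R}^+$; $f$ is increasing ($x\le y$ implies $f(x)\le f(y)$); $f$ is continuous from the right at $0$. All modulus functions are assumed unbounded. A lacunary sequence $\theta=(k_t)_{t\ge0}$ is a (strictly) increasing sequence of nonnegative integers with $k_0=0$ and $h_t=k_t-k_{t-1}\to\infty$ as $t\to\infty$; $I_t=(k_{t-1},k_t]$ denotes the corresponding block of integers. $f$ is $\theta$-compatible if $\lim_{\varepsilon\to0^+}\varphi_\theta(\varepsilon)=0$, where $\varphi_\theta(\varepsilon)=\limsup_{t\to\infty}\frac{f(h_t\varepsilon)}{f(h_t)}$. $CL(X)$ is the family of all nonempty closed subsets of $X$, and $d(x,A)=\inf_{a\in A}d(x,a)$. $\#$ denotes cardinality. For a real sequence $(x_k)_{k\ge1}$ and $L\in\mathbb{R}$: it is $\theta$-lacunary $f$-statistically convergent to $L$ if for every $\varepsilon>0$, $\lim_{t\to\infty}\frac{1}{f(h_t)}f(\#\{k\in I_t:|x_k-L|>\varepsilon\})=0$;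 it is $\theta$-lacunary $f$-strong Cesàro convergent to $L$ if $\lim_{t\to\infty}\frac{1}{f(h_t)}f\left(\sum_{k\in I_t}|x_k-L|\right)=0$; it is $\theta$-lacunary uniformly integrable if $\lim_{M\to\infty}\sup_{t\ge1}\frac{1}{h_t}\sum_{k\in I_t,\ |x_k|\ge M}|x_k|=0$. $WS_\theta^f$ (resp. $WN_\theta^f$) is the set of all sequences $(A_k)_k\subset CL(X)$ for which there is $A\in CL(X)$ such that for every $x\in X$ the real sequence $(d(x,A_k))_k$ is $\theta$-lacunary $f$-statistically convergent (resp. $\theta$-lacunary $f$-strong Cesàro convergent) to $d(x,A)$. $WI_\theta$ is the set of all sequences $(A_k)_k\subset CL(X)$ such that for every $x\in X$ the real sequence $(d(x,A_k))_k$ is $\theta$-lacunary uniformly integrable. *)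

theory Defs
  imports "HOL-Analysis.Analysis"
begin

(* Functions on [0,\<infinity>) are represented as real functions; only their values on {0..} matter. *)

definition modulus_function :: "(real \<Rightarrow> real) \<Rightarrow> bool" where
  "modulus_function f \<longleftrightarrow>
     (\<forall>x\<ge>0. f x \<ge> 0) \<and>
     (\<forall>x\<ge>0. f x = 0 \<longleftrightarrow> x = 0) \<and>
     (\<forall>x\<ge>0. \<forall>y\<ge>0. f (x + y) \<le> f x + f y) \<and>
     mono_on {0..} f \<and>
     continuous (at_right 0) f"

definition unbounded_modulus_function :: "(real \<Rightarrow> real) \<Rightarrow> bool" where
  "unbounded_modulus_function f \<longleftrightarrow> modulus_function f \<and> \<not> bounded (f ` {0..})"

(* Blocks are meaningful for t \<ge> 1. At t = 0 the truncated subtraction t - 1 gives length 0 and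
   the empty block. *)

definition block_length :: "(nat \<Rightarrow> nat) \<Rightarrow> nat \<Rightarrow> nat" where
  "block_length \<theta> t = \<theta> t - \<theta> (t - 1)"

definition block :: "(nat \<Rightarrow> nat) \<Rightarrow> nat \<Rightarrow> nat set" where
  "block \<theta> t = {\<theta> (t - 1)<..\<theta> t}"

definition lacunary :: "(nat \<Rightarrow> nat) \<Rightarrow> bool" where
  "lacunary \<theta> \<longleftrightarrow> strict_mono \<theta> \<and> \<theta> 0 = 0 \<and> filterlim (block_length \<theta>) at_top sequentially"

definition phi_lacunary :: "(nat \<Rightarrow> nat) \<Rightarrow> (real \<Rightarrow> real) \<Rightarrow> real \<Rightarrow> ereal" where
  "phi_lacunary \<theta> f \<epsilon> =
     limsup (\<lambda>t. ereal (f (real (block_length \<theta> t) * \<epsilon>) / f (real (block_length \<theta> t))))"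

definition compatible :: "(nat \<Rightarrow> nat) \<Rightarrow> (real \<Rightarrow> real) \<Rightarrow> bool" where
  "compatible \<theta> f \<longleftrightarrow> (phi_lacunary \<theta> f \<longlongrightarrow> 0) (at_right 0)"

(* Sequences are indexed by k \<ge> 1. The value at index 0 is irrelevant, since it lies in no block. *)

definition lacunary_stat_convergent ::
    "(nat \<Rightarrow> nat) \<Rightarrow> (real \<Rightarrow> real) \<Rightarrow> (nat \<Rightarrow> real) \<Rightarrow> real \<Rightarrow> bool" where
  "lacunary_stat_convergent \<theta> f x L \<longleftrightarrow>
     (\<forall>\<epsilon>>0. (\<lambda>t. 1 / f (real (block_length \<theta> t)) *
                   f (real (card {k \<in> block \<theta> t. \<bar>x k - L\<bar> > \<epsilon>}))) \<longlonglongrightarrow> 0)"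

definition lacunary_strong_Cesaro_convergent ::
    "(nat \<Rightarrow> nat) \<Rightarrow> (real \<Rightarrow> real) \<Rightarrow> (nat \<Rightarrow> real) \<Rightarrow> real \<Rightarrow> bool" where
  "lacunary_strong_Cesaro_convergent \<theta> f x L \<longleftrightarrow>
     (\<lambda>t. 1 / f (real (block_length \<theta> t)) * f (\<Sum>k\<in>block \<theta> t. \<bar>x k - L\<bar>)) \<longlonglongrightarrow> 0"

(* The supremum may be infinite for small M, hence the extended reals. *)

definition lacunary_uniformly_integrable :: "(nat \<Rightarrow> nat) \<Rightarrow> (nat \<Rightarrow> real) \<Rightarrow> bool" where
  "lacunary_uniformly_integrable \<theta> x \<longleftrightarrow>
     ((\<lambda>M::real. SUP t\<in>{1..}. ereal (1 / real (block_length \<theta> t) *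
          (\<Sum>k\<in>{k \<in> block \<theta> t. \<bar>x k\<bar> \<ge> M}. \<bar>x k\<bar>))) \<longlongrightarrow> 0) at_top"

definition CL :: "'a::metric_space set set" where
  "CL = {A. closed A \<and> A \<noteq> {}}"

definition WS :: "(nat \<Rightarrow> nat) \<Rightarrow> (real \<Rightarrow> real) \<Rightarrow> (nat \<Rightarrow> 'a::metric_space set) set" where
  "WS \<theta> f = {A. (\<forall>k\<ge>1. A k \<in> CL) \<and>
     (\<exists>B\<in>CL. \<forall>x. lacunary_stat_convergent \<theta> f (\<lambda>k. infdist x (A k)) (infdist x B))}"

definition WN :: "(nat \<Rightarrow> nat) \<Rightarrow> (real \<Rightarrow> real) \<Rightarrow> (nat \<Rightarrow> 'a::metric_space set) set" where
  "WN \<theta> f = {A. (\<forall>k\<ge>1. A k \<in> CL) \<and>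
     (\<exists>B\<in>CL. \<forall>x. lacunary_strong_Cesaro_convergent \<theta> f (\<lambda>k. infdist x (A k)) (infdist x B))}"

definition WI :: "(nat \<Rightarrow> nat) \<Rightarrow> (nat \<Rightarrow> 'a::metric_space set) set" where
  "WI \<theta> = {A. (\<forall>k\<ge>1. A k \<in> CL) \<and>
     (\<forall>x. lacunary_uniformly_integrable \<theta> (\<lambda>k. infdist x (A k)))}"

end

theory Submission
  imports Defs
begin

text \<open>
  Both inclusions hold already for a single real sequence. By Markov's inequality the number of
  indices in a block with \<open>\<bar>x\<^sub>k - L\<bar> > \<epsilon>\<close> is at most a fixed integer multiple of the block sum, and
  subadditivity gives \<open>f (n s) \<le> n f s\<close>. Conversely, split a block of length \<open>h\<close> into the indices
  with \<open>\<bar>x\<^sub>k\<bar>\<close> large, those with \<open>\<bar>x\<^sub>k - L\<bar>\<close> small, and the rest. The first two parts contribute at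
  most \<open>f (h c)\<close> each, by uniform integrability and by the choice of the threshold, which is
  negligible against \<open>f h\<close> for small \<open>c\<close> by compatibility; the third part is bounded by a
  multiple of the number of indices with \<open>\<bar>x\<^sub>k - L\<bar> > c\<close>.
\<close>

lemma modulus_function_nonneg: "modulus_function f \<Longrightarrow> 0 \<le> x \<Longrightarrow> 0 \<le> f x"
  by (simp add: modulus_function_def)

lemma modulus_function_mono: "modulus_function f \<Longrightarrow> 0 \<le> x \<Longrightarrow> x \<le> y \<Longrightarrow> f x \<le> f y"
  unfolding modulus_function_def mono_on_def by auto

lemma modulus_function_add:
  "modulus_function f \<Longrightarrow> 0 \<le> x \<Longrightarrow> 0 \<le> y \<Longrightarrow> f (x + y) \<le> f x + f y"
  by (simp add: modulus_function_def)

lemma modulus_function_mult_nat: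
  assumes f: "modulus_function f" and x: "0 \<le> x"
  shows "f (real n * x) \<le> real n * f x"
proof (induction n)
  case 0
  have "f 0 = 0" using f unfolding modulus_function_def by blast
  then show ?case by simp
next
  case (Suc n)
  have "f (real (Suc n) * x) = f (x + real n * x)"
    by (simp add: algebra_simps)
  also have "\<dots> \<le> f x + f (real n * x)"
    using x by (intro modulus_function_add[OF f]) auto
  finally show ?case
    using Suc by (simp add: algebra_simps)
qed

lemma finite_block [simp]: "finite (block \<theta> t)"
  by (simp add: block_def)

lemma card_block [simp]: "card (block \<theta> t) = block_length \<theta> t"
  by (simp add: block_def block_length_def)

lemma strong_Cesaro_imp_stat_convergent:
  assumes f: "modulus_function f"
    and conv: "lacunary_strong_Cesaro_convergent \<theta> f x L"
  shows "lacunary_stat_convergent \<theta> f x L"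
  unfolding lacunary_stat_convergent_def
proof (intro allI impI)
  fix \<epsilon> :: real
  assume \<epsilon>: "\<epsilon> > 0"
  \<comment> \<open>Markov's inequality brings in the factor 1/\<epsilon>. It is rounded up to a
    natural number because subadditivity of \<open>f\<close> only lets integer factors be pulled
    out.\<close>
  obtain n :: nat where n: "1 / \<epsilon> \<le> real n"
    using real_arch_simple by blast
  define S where "S t = (\<Sum>k\<in>block \<theta> t. \<bar>x k - L\<bar>)" for t
  define c where "c t = real (card {k \<in> block \<theta> t. \<bar>x k - L\<bar> > \<epsilon>})" for t
  define w where "w t = 1 / f (real (block_length \<theta> t))" for t
  \<comment> \<open>On an empty block \<open>f 0 = 0\<close> and division by zero gives
    \<open>w t = 0\<close>, so the weight is nonnegative but possibly not positive.\<close>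
  have w: "0 \<le> w t" for t
    unfolding w_def using modulus_function_nonneg[OF f] by simp
  have S: "0 \<le> S t" for t
    unfolding S_def by (simp add: sum_nonneg)
  have c: "0 \<le> c t" for t
    unfolding c_def by simp
  have bound: "w t * f (c t) \<le> real n * (w t * f (S t))" for t
  proof -
    let ?E = "{k \<in> block \<theta> t. \<bar>x k - L\<bar> > \<epsilon>}"
    have "c t * \<epsilon> \<le> (\<Sum>k\<in>?E. \<bar>x k - L\<bar>)"
      unfolding c_def by (rule sum_bounded_below) auto
    also have "\<dots> \<le> S t"
      unfolding S_def by (rule sum_mono2) auto
    finally have "c t \<le> 1 / \<epsilon> * S t"
      using \<epsilon> by (simp add: field_simps)
    also have "\<dots> \<le> real n * S t"
      using n S by (rule mult_right_mono)
    finally have "f (c t) \<le> f (real n * S t)"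
      by (rule modulus_function_mono[OF f c])
    also have "\<dots> \<le> real n * f (S t)"
      by (rule modulus_function_mult_nat[OF f S])
    finally have "w t * f (c t) \<le> w t * (real n * f (S t))"
      using w by (rule mult_left_mono)
    then show ?thesis by (simp add: algebra_simps)
  qed
  have "(\<lambda>t. w t * f (S t)) \<longlonglongrightarrow> 0"
    using conv unfolding lacunary_strong_Cesaro_convergent_def w_def S_def .
  then have "(\<lambda>t. real n * (w t * f (S t))) \<longlonglongrightarrow> 0"
    by (rule tendsto_mult_right_zero)
  then have "(\<lambda>t. w t * f (c t)) \<longlonglongrightarrow> 0"
    by (rule tendsto_sandwich[rotated 3, where f = "\<lambda>_. 0"])
      (auto intro!: always_eventually bound mult_nonneg_nonneg w modulus_function_nonneg[OF f c])
  then show "(\<lambda>t. 1 / f (real (block_length \<theta> t)) *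
      f (real (card {k \<in> block \<theta> t. \<bar>x k - L\<bar> > \<epsilon>}))) \<longlonglongrightarrow> 0"
    unfolding w_def c_def .
qed

text \<open>A limsup strictly below \<delta> bounds the quotients themselves for all large
  \<open>t\<close>, and the one-sided limit at 0 supplies a positive \<open>c\<close> with such a
  limsup.\<close>

lemma compatibleE:
  assumes "compatible \<theta> f" and "0 < \<delta>"
  obtains c where "0 < c"
    and "\<forall>\<^sub>F t in sequentially. f (real (block_length \<theta> t) * c) / f (real (block_length \<theta> t)) < \<delta>"
proof -
  have "\<forall>\<^sub>F c in at_right 0. phi_lacunary \<theta> f c < ereal \<delta>"
    using assms unfolding compatible_def by (intro order_tendstoD(2)) auto
  then have "\<forall>\<^sub>F c in at_right 0. phi_lacunary \<theta> f c < ereal \<delta> \<and> 0 < c"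
    using eventually_at_right_less[of "0::real"] by (rule eventually_conj)
  then obtain c where c: "phi_lacunary \<theta> f c < ereal \<delta>" "0 < c"
    using eventually_happens'[OF trivial_limit_at_right_real] by blast
  show thesis
    using that[OF c(2)] Limsup_lessD[OF c(1)[unfolded phi_lacunary_def]] by simp
qed

text \<open>The limit is taken as \<open>M\<close> tends to infinity, so the threshold can be pushed
  above any prescribed \<open>K\<close>; \<open>K = \<bar>L\<bar>\<close> is what the splitting of
  the block sum requires.\<close>

lemma lacunary_uniformly_integrableE:
  assumes "lacunary_uniformly_integrable \<theta> x" and "0 < \<eta>"
  obtains M where "K \<le> M"
    and "\<And>t. t \<ge> 1 \<Longrightarrow>
      (\<Sum>k\<in>{k \<in> block \<theta> t. M \<le> \<bar>x k\<bar>}. \<bar>x k\<bar>) \<le> real (block_length \<theta> t) * \<eta>"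
proof -
  let ?s = "\<lambda>M t. \<Sum>k\<in>{k \<in> block \<theta> t. M \<le> \<bar>x k\<bar>}. \<bar>x k\<bar>"
  have "\<forall>\<^sub>F M in at_top. (SUP t\<in>{1..}. ereal (1 / real (block_length \<theta> t) * ?s M t)) < ereal \<eta>"
    using assms unfolding lacunary_uniformly_integrable_def by (intro order_tendstoD(2)) auto
  then have "\<forall>\<^sub>F M in at_top.
      (SUP t\<in>{1..}. ereal (1 / real (block_length \<theta> t) * ?s M t)) < ereal \<eta> \<and> K \<le> M"
    using eventually_ge_at_top by (rule eventually_conj)
  then obtain M where M: "K \<le> M"
    and sup: "(SUP t\<in>{1..}. ereal (1 / real (block_length \<theta> t) * ?s M t)) < ereal \<eta>"
    using eventually_happens'[OF trivial_limit_at_top_linorder] by blast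
  have "?s M t \<le> real (block_length \<theta> t) * \<eta>" if t: "t \<ge> 1" for t
  \<comment> \<open>For length 0 the averaged sum is 0 by the division convention and its bound
    carries no information; there the block is empty.\<close>
  proof (cases "block_length \<theta> t = 0")
    case True
    then have "block \<theta> t = {}"
      using card_block[of \<theta> t] finite_block[of \<theta> t] by (simp del: card_block)
    then show ?thesis using True by simp
  next
    case False
    have "ereal (1 / real (block_length \<theta> t) * ?s M t)
        \<le> (SUP t\<in>{1..}. ereal (1 / real (block_length \<theta> t) * ?s M t))"
      by (rule SUP_upper) (use t in simp)
    then have "ereal (1 / real (block_length \<theta> t) * ?s M t) < ereal \<eta>"
      using sup by (rule order_le_less_trans)
    then show ?thesis using False by (simp add: field_simps)
  qed
  then show thesis using that M by blast
qed

text \<open>The bound holds term by term. If \<open>M \<le> \<bar>x k\<bar>\<close>, then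
  \<open>\<bar>x k - L\<bar> \<le> \<bar>x k\<bar> + \<bar>L\<bar> \<le> 2 * \<bar>x
  k\<bar>\<close>, as \<open>\<bar>L\<bar> \<le> M\<close>. Otherwise the term is at most
  \<open>M + \<bar>L\<bar>\<close>, and it is either at most \<open>c\<close> or counted by the
  cardinality. Overlaps do no harm, since all summands are nonnegative.\<close>

lemma block_sum_split:
  assumes "\<bar>L\<bar> \<le> M" and "0 \<le> c"
  shows "(\<Sum>k\<in>block \<theta> t. \<bar>x k - L\<bar>) \<le> real (block_length \<theta> t) * c
    + 2 * (\<Sum>k\<in>{k \<in> block \<theta> t. M \<le> \<bar>x k\<bar>}. \<bar>x k\<bar>)
    + (M + \<bar>L\<bar>) * real (card {k \<in> block \<theta> t. \<bar>x k - L\<bar> > c})"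
proof -
  have "(\<Sum>k\<in>block \<theta> t. \<bar>x k - L\<bar>) \<le> (\<Sum>k\<in>block \<theta> t. c + 2 * (if M \<le> \<bar>x k\<bar> then \<bar>x k\<bar> else 0)
      + (M + \<bar>L\<bar>) * (if \<bar>x k - L\<bar> > c then 1 else 0))"
    using assms by (intro sum_mono) auto
  also have "\<dots> = real (block_length \<theta> t) * c
      + 2 * (\<Sum>k\<in>block \<theta> t. if M \<le> \<bar>x k\<bar> then \<bar>x k\<bar> else 0)
      + (M + \<bar>L\<bar>) * (\<Sum>k\<in>block \<theta> t. if \<bar>x k - L\<bar> > c then 1 else 0)"
    by (simp only: sum.distrib sum_distrib_left sum_constant card_block)
  finally show ?thesis
    by (simp flip: sum.inter_filter)
qed

lemma stat_convergent_imp_strong_Cesaro: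
  assumes f: "modulus_function f" and comp: "compatible \<theta> f"
    and conv: "lacunary_stat_convergent \<theta> f x L"
    and ui: "lacunary_uniformly_integrable \<theta> x"
  shows "lacunary_strong_Cesaro_convergent \<theta> f x L"
proof -
  define h where "h t = real (block_length \<theta> t)" for t
  define S where "S t = (\<Sum>k\<in>block \<theta> t. \<bar>x k - L\<bar>)" for t
  have h: "0 \<le> h t" for t
    unfolding h_def by simp
  have S: "0 \<le> S t" for t
    unfolding S_def by (simp add: sum_nonneg)
  have w: "0 \<le> 1 / f (h t)" for t
    using modulus_function_nonneg[OF f h] by simp
  have "(\<lambda>t. 1 / f (h t) * f (S t)) \<longlonglongrightarrow> 0"
  proof (rule tendstoI)
    fix \<delta> :: real
    assume "0 < \<delta>"
    then have \<delta>: "0 < \<delta> / 3" by simp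
    \<comment> \<open>The constants are chosen in the order \<open>c\<close>, \<open>M\<close>,
      \<open>n\<close>, all before \<open>t\<close>; so \<open>n\<close> stays fixed when
      statistical convergence is used at level \<open>c\<close>.\<close>
    obtain c where c: "0 < c" and small: "\<forall>\<^sub>F t in sequentially. f (h t * c) / f (h t) < \<delta> / 3"
      using compatibleE[OF comp \<delta>] unfolding h_def by blast
    \<comment> \<open>Half of \<open>c\<close> offsets the factor 2 in
      \<open>block_sum_split\<close>, so that the tail also contributes at most
      \<open>h t * c\<close>.\<close>
    have "0 < c / 2" using c by simp
    then obtain M where M: "\<bar>L\<bar> \<le> M"
      and tail: "\<And>t. t \<ge> 1 \<Longrightarrow> (\<Sum>k\<in>{k \<in> block \<theta> t. M \<le> \<bar>x k\<bar>}. \<bar>x k\<bar>) \<le> h t * (c / 2)"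
      using lacunary_uniformly_integrableE[OF ui, of "c / 2" "\<bar>L\<bar>"] unfolding h_def by blast
    obtain n :: nat where n: "M + \<bar>L\<bar> \<le> real n"
      using real_arch_simple by blast
    define N where "N t = real (card {k \<in> block \<theta> t. \<bar>x k - L\<bar> > c})" for t
    have N: "0 \<le> N t" for t
      unfolding N_def by simp
    have "(\<lambda>t. real n * (1 / f (h t) * f (N t))) \<longlonglongrightarrow> 0"
      using conv c unfolding lacunary_stat_convergent_def h_def N_def
      by (intro tendsto_mult_right_zero) blast
    then have "\<forall>\<^sub>F t in sequentially. real n * (1 / f (h t) * f (N t)) < \<delta> / 3"
      using \<delta> by (rule order_tendstoD(2))
    then show "\<forall>\<^sub>F t in sequentially. dist (1 / f (h t) * f (S t)) 0 < \<delta>"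
      using small eventually_ge_at_top[of 1]
    proof eventually_elim
      case (elim t)
      have "S t \<le> h t * c + 2 * (\<Sum>k\<in>{k \<in> block \<theta> t. M \<le> \<bar>x k\<bar>}. \<bar>x k\<bar>) + (M + \<bar>L\<bar>) * N t"
        unfolding S_def h_def N_def using block_sum_split[OF M] c by simp
      also have "\<dots> \<le> h t * c + h t * c + real n * N t"
        using tail[OF elim(3)] mult_right_mono[OF n N] by (intro add_mono) auto
      finally have "f (S t) \<le> f (h t * c + h t * c + real n * N t)"
        by (rule modulus_function_mono[OF f S])
      also have "\<dots> \<le> f (h t * c + h t * c) + f (real n * N t)"
        using h N c by (intro modulus_function_add[OF f]) auto
      also have "\<dots> \<le> (f (h t * c) + f (h t * c)) + real n * f (N t)"
        using h N c by (intro add_mono modulus_function_add[OF f] modulus_function_mult_nat[OF f]) auto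
      finally have "1 / f (h t) * f (S t)
          \<le> 1 / f (h t) * ((f (h t * c) + f (h t * c)) + real n * f (N t))"
        using w by (rule mult_left_mono)
      also have "\<dots> = f (h t * c) / f (h t) + f (h t * c) / f (h t)
          + real n * (1 / f (h t) * f (N t))"
        by (simp add: add_divide_distrib)
      \<comment> \<open>Each of the three summands is below \<delta>/3.\<close>
      also have "\<dots> < \<delta>"
        using elim(1,2) by linarith
      finally have "1 / f (h t) * f (S t) < \<delta>" .
      moreover have "0 \<le> 1 / f (h t) * f (S t)"
        by (intro mult_nonneg_nonneg w modulus_function_nonneg[OF f S])
      ultimately show ?case by (simp add: dist_real_def)
    qed
  qed
  then show ?thesis
    unfolding lacunary_strong_Cesaro_convergent_def h_def S_def .
qed

theorem theorem3p6:
  shows "(\<forall>\<theta> f. lacunary \<theta> \<and> unbounded_modulus_function f \<longrightarrow>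
            (WN \<theta> f :: (nat \<Rightarrow> 'a::metric_space set) set) \<subseteq> WS \<theta> f) \<and>
         (\<forall>\<theta> f. lacunary \<theta> \<and> unbounded_modulus_function f \<and> compatible \<theta> f \<longrightarrow>
            (WS \<theta> f :: (nat \<Rightarrow> 'a::metric_space set) set) \<inter> WI \<theta> \<subseteq> WN \<theta> f)"
  \<comment> \<open>For each point \<open>x\<close> the scalar results apply to the distances
    \<open>infdist x (A k)\<close> with limit \<open>infdist x B\<close>; the same limit set
    \<open>B\<close> serves both kinds of convergence.\<close>
  unfolding WN_def WS_def WI_def unbounded_modulus_function_def
  using strong_Cesaro_imp_stat_convergent stat_convergent_imp_strong_Cesaro by blast

end
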